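(* Let $a > b$ be two magnitudes (positive real numbers). If the anthyphairesis of $a$ to $b$ is infinite, then $a$ and $b$ are incommensurable.
   Context: Magnitudes of one kind (e.g. lines, i.e. straight-line segments) are represented by positive real numbers. Two magnitudes $a,b$ are commensurable if there are a magnitude $c$ and positive integers $m,n$ with $a=mc$, $b=nc$ (equivalently $a/b$ is a rational number); otherwise they are incommensurable. For magnitudes $a>b$, the anthyphairesis of $a$ to $b$ is the process of successive divisions with remainder: put $c_{-1}=a$, $c_0=b$ and, as long as possible, $c_{n-1}=k_n c_n+c_{n+1}$ with $k_n$ a positive integer and $0<c_{n+1}<c_n$ (so $a=k_0b+c_1$, $b=k_1c_1+c_2$, $c_1=k_2c_2+c_3$, and so on). The anthyphairesis is finite if at some stage $c_n$ divides $c_{n-1}$ exactly, i.e. $c_{n-1}=k_nc_n$ for a positive integer $k_n$ (and the process then stops); otherwise it is infinite. *)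

theory Defs
  imports Complex_Main
begin

definition commensurable :: "real \<Rightarrow> real \<Rightarrow> bool" where
  "commensurable a b \<longleftrightarrow>
     (\<exists>c m n. c > 0 \<and> m > 0 \<and> n > 0 \<and> a = real m * c \<and> b = real n * c)"

abbreviation incommensurable :: "real \<Rightarrow> real \<Rightarrow> bool" where
  "incommensurable a b \<equiv> \<not> commensurable a b"

(* The remainders are numbered from 0 instead of -1: c 0 = a, c 1 = b, and c (n + 1) is the
   customary c_n. The predicate says that k 0, ..., k (N - 1) and c 2, ..., c (N + 1) are the
   quotients and remainders of the first N divisions, each of which leaves a nonzero remainder;
   the values of k and c at larger indices are irrelevant. *)
definition anthyphairesis_steps ::
    "real \<Rightarrow> real \<Rightarrow> nat \<Rightarrow> (nat \<Rightarrow> nat) \<Rightarrow> (nat \<Rightarrow> real) \<Rightarrow> bool" where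
  "anthyphairesis_steps a b N k c \<longleftrightarrow>
     c 0 = a \<and> c 1 = b \<and>
     (\<forall>n<N. k n > 0 \<and> c n = real (k n) * c (n + 1) + c (n + 2) \<and>
            0 < c (n + 2) \<and> c (n + 2) < c (n + 1))"

(* After N divisions with remainder (possibly N = 0) the next division is exact. *)
definition anthyphairesis_finite :: "real \<Rightarrow> real \<Rightarrow> bool" where
  "anthyphairesis_finite a b \<longleftrightarrow>
     (\<exists>N k c. anthyphairesis_steps a b N k c \<and> k N > 0 \<and> c N = real (k N) * c (N + 1))"

abbreviation anthyphairesis_infinite :: "real \<Rightarrow> real \<Rightarrow> bool" where
  "anthyphairesis_infinite a b \<equiv> \<not> anthyphairesis_finite a b"

end

theory Submission imports Defs begin

text \<open>
  The contrapositive is Euclid's algorithm. If \<open>a = m c\<close> and \<open>b = n c\<close> with a common measure \<open>c\<close>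
  and positive integers \<open>m > n\<close>, then dividing \<open>a\<close> by \<open>b\<close> with remainder amounts to dividing \<open>m\<close>
  by \<open>n\<close>: the remainder is again a multiple of \<open>c\<close>, with a smaller coefficient. These coefficients
  are natural numbers, so they cannot decrease forever, and some division must be exact
  (\<open>anthyphairesis_finite_multiples\<close>). The induction prepends one division to the anthyphairesis
  of the divisor to the remainder (\<open>anthyphairesis_finite_division\<close>).
\<close>

lemma anthyphairesis_finite_exact:
  assumes "q > 0" and "a = real q * b"
  shows "anthyphairesis_finite a b"
proof -
  have "anthyphairesis_steps a b 0 (\<lambda>_. q) (case_nat a (\<lambda>_. b))"
    by (simp add: anthyphairesis_steps_def)
  with assms show ?thesis
    unfolding anthyphairesis_finite_def
    by (intro exI[of _ 0] exI[of _ "\<lambda>_. q"] exI[of _ "case_nat a (\<lambda>_. b)"]) simp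
qed

text \<open>
  The anthyphairesis of \<open>a\<close> to \<open>b\<close> is its first division followed by the anthyphairesis of \<open>b\<close> to
  the remainder, so prepending the quotient and the dividend shifts both sequences by one.
\<close>
lemma anthyphairesis_finite_division:
  assumes "q > 0" and "a = real q * b + r" and "0 < r" and "r < b"
    and "anthyphairesis_finite b r"
  shows "anthyphairesis_finite a b"
proof -
  obtain N k c where steps: "anthyphairesis_steps b r N k c"
    and exact: "k N > 0" "c N = real (k N) * c (N + 1)"
    using assms(5) unfolding anthyphairesis_finite_def by blast
  have start: "c 0 = b" "c 1 = r"
    and step: "\<forall>n<N. k n > 0 \<and> c n = real (k n) * c (n + 1) + c (n + 2) \<and>
      0 < c (n + 2) \<and> c (n + 2) < c (n + 1)"
    using steps unfolding anthyphairesis_steps_def by blast+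
  define k' where "k' = case_nat q k"
  define c' where "c' = case_nat a c"
  have shift: "k' 0 = q" "k' (Suc n) = k n" "c' 0 = a" "c' (Suc n) = c n" for n
    by (simp_all add: k'_def c'_def)
  have "k' n > 0 \<and> c' n = real (k' n) * c' (n + 1) + c' (n + 2) \<and>
      0 < c' (n + 2) \<and> c' (n + 2) < c' (n + 1)" if "n < Suc N" for n
  proof (cases n)
    case 0
    with start assms(1-4) show ?thesis by (simp add: shift numeral_2_eq_2)
  next
    case (Suc i)
    with that have "i < N" by simp
    from step[rule_format, OF this] show ?thesis
      unfolding Suc add_Suc shift .
  qed
  with start have "anthyphairesis_steps a b (Suc N) k' c'"
    unfolding anthyphairesis_steps_def by (metis One_nat_def shift(3,4))
  with exact show ?thesis
    unfolding anthyphairesis_finite_def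
    by (intro exI[of _ "Suc N"] exI[of _ k'] exI[of _ c']) (simp add: shift)
qed

lemma anthyphairesis_finite_multiples:
  fixes c :: real
  assumes "c > 0" and "0 < n" and "n < m"
  shows "anthyphairesis_finite (real m * c) (real n * c)"
  using assms(2,3)
proof (induction n arbitrary: m rule: less_induct)
  case (less n)
  have quotient: "m div n > 0"
    using less.prems by (simp only: div_greater_zero_iff less_imp_le)
  have "real m = real (m div n) * real n + real (m mod n)"
    by (metis div_mult_mod_eq of_nat_add of_nat_mult)
  then have division: "real m * c = real (m div n) * (real n * c) + real (m mod n) * c"
    by (simp add: algebra_simps)
  show ?case
  proof (cases "m mod n = 0")
    case True
    then have "real m * c = real (m div n) * (real n * c)"
      by (subst division) simp
    with quotient show ?thesis
      by (rule anthyphairesis_finite_exact)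
  next
    case False
    then have remainder: "0 < m mod n" "m mod n < n"
      using less.prems by simp_all
    then have "anthyphairesis_finite (real n * c) (real (m mod n) * c)"
      using less.IH by blast
    moreover have "0 < real (m mod n) * c" "real (m mod n) * c < real n * c"
      using remainder \<open>c > 0\<close> by (simp_all only: mult_pos_pos of_nat_0_less_iff
          mult_less_cancel_right_pos of_nat_less_iff)
    ultimately show ?thesis
      using anthyphairesis_finite_division[OF quotient division] by blast
  qed
qed

theorem propositionX2:
  fixes a b :: real
  assumes "a > 0" and "b > 0" and "a > b"
    and "anthyphairesis_infinite a b"
  shows "incommensurable a b"
proof
  assume "commensurable a b"
  then obtain c m n where "c > 0" "n > 0" "a = real m * c" "b = real n * c"
    unfolding commensurable_def by blast
  with \<open>a > b\<close> have "anthyphairesis_finite a b"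
    by (simp add: anthyphairesis_finite_multiples)
  with assms(4) show False by contradiction
qed

end
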